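(* Let $S$ be a left simple semigroup. Then every two normal series of $S$ have isomorphic refinements; that is, for any two normal series $S=S_0\supseteq S_1\supseteq\dots\supseteq S_k$ and $S=H_0\supseteq H_1\supseteq\dots\supseteq H_n$ of $S$ there exist a normal series of $S$ which is a refinement of the first and a normal series of $S$ which is a refinement of the second such that these two refinements are isomorphic.
   Context: A semigroup $S$ is left simple if for all $a,b\in S$ there is $s\in S$ with $sa=b$. Subsemigroups are non-empty. A subset $H$ of a semigroup $S$ is reflexive in $S$ if $ab\in H$ implies $ba\in H$ for all $a,b\in S$. A subset $U$ of $S$ is left [right] unitary in $S$ if $ab,a\in U$ implies $b\in U$ [$ab,b\in U$ implies $a\in U$] for all $a,b\in S$; it is unitary in $S$ if it is both left and right unitary in $S$. A reflexive unitary subsemigroup of $S$ is a subsemigroup that is reflexive and unitary in $S$. For a non-empty subset $H$ of a semigroup $T$, the principal congruence on $T$ determined by $H$ is $P_H(T)=\{(a,b)\in T\times T:\ \text{for all } s,t\in T,\ sat\in H \iff sbt\in H\}$; it is a congruence on $T$. One writes $T/P_H$ for the factor semigroup $T/P_H(T)$. If $T$ is left simple and $H$ is a reflexive unitary subsemigroup of $T$, then $T/P_H$ is a group with identity element $H$. A normal series of a left simple semigroup $S$ is a finite sequence $S=S_0\supseteq S_1\supseteq\dots\supseteq S_k$ of subsemigroups of $S$ such that $S_i$ is a reflexive unitary subsemigroup of $S_{i-1}$ for $i=1,\dots,k$. The integer $k$ is its length; its factors are the groups $S_{i-1}/P_{S_i}$ ($=S_{i-1}/P_{S_i}(S_{i-1})$),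 $i=1,\dots,k$. Two normal series $S=S_0\supseteq\dots\supseteq S_k$ and $S=H_0\supseteq\dots\supseteq H_n$ are isomorphic if $n=k$ and there is a permutation $i\mapsto i^*$ of $\{1,\dots,k\}$ such that $S_{i-1}/P_{S_i}$ and $H_{i^*-1}/P_{H_{i^*}}$ are isomorphic for $i=1,\dots,k$. The normal series $S=H_0\supseteq\dots\supseteq H_n$ is a refinement of $S=S_0\supseteq\dots\supseteq S_k$ if $n\ge k$ and every $S_i$ ($i=1,\dots,k$) equals some $H_j$ ($j\in\{1,\dots,n\}$). *)

theory Defs
  imports "HOL-Algebra.Group" "HOL-Combinatorics.Permutations"
begin

(* Semigroups are carried by the monoid records of HOL-Algebra, so that hom, iso and the relation
   G \<cong> H are available. Nothing is assumed about the field one of such a record, and no definition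
   below reads it. *)

locale alg_semigroup =
  fixes S (structure)
  assumes m_closed: "\<lbrakk>x \<in> carrier S; y \<in> carrier S\<rbrakk> \<Longrightarrow> x \<otimes> y \<in> carrier S"
    and m_assoc: "\<lbrakk>x \<in> carrier S; y \<in> carrier S; z \<in> carrier S\<rbrakk>
      \<Longrightarrow> (x \<otimes> y) \<otimes> z = x \<otimes> (y \<otimes> z)"

locale left_simple_semigroup = alg_semigroup +
  assumes left_simple: "\<lbrakk>a \<in> carrier S; b \<in> carrier S\<rbrakk> \<Longrightarrow> \<exists>s\<in>carrier S. s \<otimes> a = b"

definition subsemigroup :: "'a set \<Rightarrow> ('a, 'b) monoid_scheme \<Rightarrow> bool" where
  "subsemigroup H S \<longleftrightarrow>
     H \<noteq> {} \<and> H \<subseteq> carrier S \<and> (\<forall>a\<in>H. \<forall>b\<in>H. a \<otimes>\<^bsub>S\<^esub> b \<in> H)"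

definition reflexive_in :: "'a set \<Rightarrow> ('a, 'b) monoid_scheme \<Rightarrow> bool" where
  "reflexive_in H S \<longleftrightarrow>
     (\<forall>a\<in>carrier S. \<forall>b\<in>carrier S. a \<otimes>\<^bsub>S\<^esub> b \<in> H \<longrightarrow> b \<otimes>\<^bsub>S\<^esub> a \<in> H)"

definition left_unitary_in :: "'a set \<Rightarrow> ('a, 'b) monoid_scheme \<Rightarrow> bool" where
  "left_unitary_in U S \<longleftrightarrow>
     (\<forall>a\<in>carrier S. \<forall>b\<in>carrier S. a \<otimes>\<^bsub>S\<^esub> b \<in> U \<and> a \<in> U \<longrightarrow> b \<in> U)"

definition right_unitary_in :: "'a set \<Rightarrow> ('a, 'b) monoid_scheme \<Rightarrow> bool" where
  "right_unitary_in U S \<longleftrightarrow>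
     (\<forall>a\<in>carrier S. \<forall>b\<in>carrier S. a \<otimes>\<^bsub>S\<^esub> b \<in> U \<and> b \<in> U \<longrightarrow> a \<in> U)"

definition unitary_in :: "'a set \<Rightarrow> ('a, 'b) monoid_scheme \<Rightarrow> bool" where
  "unitary_in U S \<longleftrightarrow> left_unitary_in U S \<and> right_unitary_in U S"

definition reflexive_unitary_subsemigroup :: "'a set \<Rightarrow> ('a, 'b) monoid_scheme \<Rightarrow> bool" where
  "reflexive_unitary_subsemigroup H S \<longleftrightarrow>
     subsemigroup H S \<and> reflexive_in H S \<and> unitary_in H S"

definition principal_congruence :: "('a, 'b) monoid_scheme \<Rightarrow> 'a set \<Rightarrow> ('a \<times> 'a) set" where
  "principal_congruence T H =
     {(a, b) \<in> carrier T \<times> carrier T. \<forall>s\<in>carrier T. \<forall>t\<in>carrier T.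
        s \<otimes>\<^bsub>T\<^esub> a \<otimes>\<^bsub>T\<^esub> t \<in> H \<longleftrightarrow> s \<otimes>\<^bsub>T\<^esub> b \<otimes>\<^bsub>T\<^esub> t \<in> H}"

(* Classes are multiplied by [a][b] = [ab], written as a union over all representatives; the
   set-wise product of two classes can be a proper subset of [ab]. The field one is meaningful only
   when H is itself the identity class; see factor_semigroup_group below. *)
definition factor_semigroup :: "('a, 'b) monoid_scheme \<Rightarrow> 'a set \<Rightarrow> 'a set monoid" where
  "factor_semigroup T H =
     \<lparr>carrier = carrier T // principal_congruence T H,
      monoid.mult = (\<lambda>A B. \<Union>a\<in>A. \<Union>b\<in>B. principal_congruence T H `` {a \<otimes>\<^bsub>T\<^esub> b}),
      one = H\<rparr>"

(* Only the values A 0, ..., A k are relevant: k is the length of the series. *)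
definition normal_series :: "('a, 'b) monoid_scheme \<Rightarrow> (nat \<Rightarrow> 'a set) \<Rightarrow> nat \<Rightarrow> bool" where
  "normal_series S A k \<longleftrightarrow>
     A 0 = carrier S \<and>
     (\<forall>i\<in>{0..k}. subsemigroup (A i) S) \<and>
     (\<forall>i\<in>{1..k}. reflexive_unitary_subsemigroup (A i) (S\<lparr>carrier := A (i - 1)\<rparr>))"

definition series_factor :: "('a, 'b) monoid_scheme \<Rightarrow> (nat \<Rightarrow> 'a set) \<Rightarrow> nat \<Rightarrow> 'a set monoid" where
  "series_factor S A i = factor_semigroup (S\<lparr>carrier := A (i - 1)\<rparr>) (A i)"

definition isomorphic_series ::
  "('a, 'b) monoid_scheme \<Rightarrow> (nat \<Rightarrow> 'a set) \<Rightarrow> nat \<Rightarrow> (nat \<Rightarrow> 'a set) \<Rightarrow> nat \<Rightarrow> bool" where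
  "isomorphic_series S A k B n \<longleftrightarrow>
     n = k \<and> (\<exists>p. p permutes {1..k} \<and>
                (\<forall>i\<in>{1..k}. series_factor S A i \<cong> series_factor S B (p i)))"

definition series_refinement :: "(nat \<Rightarrow> 'a set) \<Rightarrow> nat \<Rightarrow> (nat \<Rightarrow> 'a set) \<Rightarrow> nat \<Rightarrow> bool" where
  "series_refinement B n A k \<longleftrightarrow> n \<ge> k \<and> (\<forall>i\<in>{1..k}. \<exists>j\<in>{1..n}. A i = B j)"

lemma (in alg_semigroup) equiv_principal_congruence:
  "equiv (carrier S) (principal_congruence S H)"
  unfolding equiv_def refl_on_def sym_on_def trans_def principal_congruence_def by auto

lemma (in alg_semigroup) principal_congruence_mult:
  assumes "(a, a') \<in> principal_congruence S H" "(b, b') \<in> principal_congruence S H"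
  shows "(a \<otimes> b, a' \<otimes> b') \<in> principal_congruence S H"
proof -
  have c: "a \<in> carrier S" "a' \<in> carrier S" "b \<in> carrier S" "b' \<in> carrier S"
    using assms unfolding principal_congruence_def by auto
  have "s \<otimes> (a \<otimes> b) \<otimes> t \<in> H \<longleftrightarrow> s \<otimes> (a' \<otimes> b') \<otimes> t \<in> H"
    if st: "s \<in> carrier S" "t \<in> carrier S" for s t
  proof -
    have "s \<otimes> (a \<otimes> b) \<otimes> t = s \<otimes> a \<otimes> (b \<otimes> t)" "s \<otimes> a' \<otimes> (b \<otimes> t) = (s \<otimes> a') \<otimes> b \<otimes> t"
      "s \<otimes> (a' \<otimes> b') \<otimes> t = (s \<otimes> a') \<otimes> b' \<otimes> t"
      using c st by (simp_all add: m_assoc m_closed)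
    then show ?thesis
      using assms c st m_closed unfolding principal_congruence_def by auto
  qed
  then show ?thesis
    using c m_closed unfolding principal_congruence_def by auto
qed

lemma (in alg_semigroup) factor_semigroup_mult_class:
  assumes "a \<in> carrier S" "b \<in> carrier S"
  shows "principal_congruence S H `` {a} \<otimes>\<^bsub>factor_semigroup S H\<^esub> principal_congruence S H `` {b}
         = principal_congruence S H `` {a \<otimes> b}"
proof -
  have "congruent2 (principal_congruence S H) (principal_congruence S H)
          (\<lambda>a b. principal_congruence S H `` {a \<otimes> b})"
    unfolding congruent2_def
    using principal_congruence_mult equiv_class_eq[OF equiv_principal_congruence] by blast
  from UN_equiv_class2[OF equiv_principal_congruence equiv_principal_congruence this assms]
  show ?thesis unfolding factor_semigroup_def by simp
qed

lemma (in left_simple_semigroup) factor_semigroup_group: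
  assumes H: "reflexive_unitary_subsemigroup H S"
  shows "group (factor_semigroup S H)"
proof -
  let ?P = "principal_congruence S H"
  let ?F = "factor_semigroup S H"
  have ne: "H \<noteq> {}" and sub: "\<And>x. x \<in> H \<Longrightarrow> x \<in> carrier S"
    and cl: "\<And>x y. x \<in> H \<Longrightarrow> y \<in> H \<Longrightarrow> x \<otimes> y \<in> H"
    and rf: "\<And>x y. x \<in> carrier S \<Longrightarrow> y \<in> carrier S \<Longrightarrow> x \<otimes> y \<in> H \<Longrightarrow> y \<otimes> x \<in> H"
    and lu: "\<And>x y. x \<in> carrier S \<Longrightarrow> y \<in> carrier S \<Longrightarrow> x \<otimes> y \<in> H \<Longrightarrow> x \<in> H \<Longrightarrow> y \<in> H"
    and ru: "\<And>x y. x \<in> carrier S \<Longrightarrow> y \<in> carrier S \<Longrightarrow> x \<otimes> y \<in> H \<Longrightarrow> y \<in> H \<Longrightarrow> x \<in> H"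
    using H unfolding reflexive_unitary_subsemigroup_def subsemigroup_def reflexive_in_def
      unitary_in_def left_unitary_in_def right_unitary_in_def by blast+
  have hm: "h \<otimes> x \<in> H \<longleftrightarrow> x \<in> H" if "h \<in> H" "x \<in> carrier S" for h x
    using that lu cl sub by blast
  have rot: "s \<otimes> b \<otimes> t \<in> H \<longleftrightarrow> b \<otimes> (t \<otimes> s) \<in> H"
    if "s \<in> carrier S" "b \<in> carrier S" "t \<in> carrier S" for s b t
    using that rf[of s "b \<otimes> t"] rf[of "b \<otimes> t" s] by (auto simp: m_assoc m_closed)
  have P1: "(h, h') \<in> ?P" if "h \<in> H" "h' \<in> H" for h h'
    using that sub unfolding principal_congruence_def by (auto simp: rot hm m_closed)
  have P2: "b \<in> H" if "(h, b) \<in> ?P" "h \<in> H" for h b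
  proof -
    have b: "b \<in> carrier S" and "h \<otimes> h \<otimes> h \<in> H \<longleftrightarrow> h \<otimes> b \<otimes> h \<in> H"
      using that sub unfolding principal_congruence_def by auto
    then have "h \<otimes> b \<otimes> h \<in> H" using that cl by blast
    then have "h \<otimes> b \<in> H"
      using ru[of "h \<otimes> b" h] b sub[OF that(2)] that(2) m_closed by simp
    then show ?thesis using hm[OF that(2) b] by simp
  qed
  have cls: "?P `` {h} = H" if "h \<in> H" for h
    using that P1 P2 by auto
  obtain e where e: "e \<in> H" using ne by blast
  have idP: "(e \<otimes> a, a) \<in> ?P" if a: "a \<in> carrier S" for a
  proof -
    have "s \<otimes> (e \<otimes> a) \<otimes> t \<in> H \<longleftrightarrow> s \<otimes> a \<otimes> t \<in> H"
      if st: "s \<in> carrier S" "t \<in> carrier S" for s t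
    proof -
      have "s \<otimes> (e \<otimes> a) \<otimes> t \<in> H \<longleftrightarrow> e \<otimes> (a \<otimes> (t \<otimes> s)) \<in> H"
        using a st sub[OF e] by (simp add: rot m_closed m_assoc[of e a])
      also have "\<dots> \<longleftrightarrow> s \<otimes> a \<otimes> t \<in> H"
        using a st e by (simp add: rot hm m_closed)
      finally show ?thesis .
    qed
    then show ?thesis
      using a sub[OF e] m_closed unfolding principal_congruence_def by auto
  qed
  have carr: "\<exists>a\<in>carrier S. x = ?P `` {a}" if "x \<in> carrier ?F" for x
    using that by (auto simp: factor_semigroup_def quotient_def)
  have inc: "?P `` {a} \<in> carrier ?F" if "a \<in> carrier S" for a
    using that by (simp add: factor_semigroup_def quotientI)
  have one: "\<one>\<^bsub>?F\<^esub> = ?P `` {e}" using cls[OF e] by (simp add: factor_semigroup_def)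
  show ?thesis
  proof (rule groupI)
    show "\<one>\<^bsub>?F\<^esub> \<in> carrier ?F" using one inc e sub by simp
  next
    fix x y assume "x \<in> carrier ?F" "y \<in> carrier ?F"
    then obtain a b where "a \<in> carrier S" "b \<in> carrier S" "x = ?P `` {a}" "y = ?P `` {b}"
      using carr[of x] carr[of y] by blast
    then show "x \<otimes>\<^bsub>?F\<^esub> y \<in> carrier ?F"
      by (simp add: factor_semigroup_mult_class inc m_closed)
  next
    fix x y z assume "x \<in> carrier ?F" "y \<in> carrier ?F" "z \<in> carrier ?F"
    then obtain a b c where "a \<in> carrier S" "b \<in> carrier S" "c \<in> carrier S"
      "x = ?P `` {a}" "y = ?P `` {b}" "z = ?P `` {c}"
      using carr[of x] carr[of y] carr[of z] by blast
    then show "x \<otimes>\<^bsub>?F\<^esub> y \<otimes>\<^bsub>?F\<^esub> z = x \<otimes>\<^bsub>?F\<^esub> (y \<otimes>\<^bsub>?F\<^esub> z)"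
      by (simp add: factor_semigroup_mult_class m_closed m_assoc)
  next
    fix x assume "x \<in> carrier ?F"
    then obtain a where a: "a \<in> carrier S" "x = ?P `` {a}" using carr[of x] by blast
    then show "\<one>\<^bsub>?F\<^esub> \<otimes>\<^bsub>?F\<^esub> x = x"
      using one sub[OF e] equiv_class_eq[OF equiv_principal_congruence idP[OF a(1)]]
      by (simp add: factor_semigroup_mult_class)
    obtain s where s: "s \<in> carrier S" "s \<otimes> a = e" using left_simple[OF a(1) sub[OF e]] by blast
    then have "?P `` {s} \<otimes>\<^bsub>?F\<^esub> x = \<one>\<^bsub>?F\<^esub>"
      using a one by (simp add: factor_semigroup_mult_class)
    then show "\<exists>y\<in>carrier ?F. y \<otimes>\<^bsub>?F\<^esub> x = \<one>\<^bsub>?F\<^esub>"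
      using inc[OF s(1)] by blast
  qed
qed

end

(* Schreier's argument, transferred from groups. For N reflexive unitary in a left simple T the
   role of the product N L is played by the preimage of the image of L in the group T/P_N; the image
   of a left simple subsemigroup in a group is a subgroup, so these preimages behave as products
   N L do in groups, and Zassenhaus' lemma holds because both quotients are isomorphic to the same
   quotient of the intersection. There is no trivial subsemigroup in which both series could end:
   instead the first is continued by the sets A_k \<inter> B_j and the second by the sets B_n \<inter> A_i, so
   that both end in A_k \<inter> B_n. This set is non-empty because s a = a with a in a member of a series
   forces s into the next member. *)

theory Submission
  imports Defs
begin

section \<open>Left simple subsemigroups and their images in groups\<close>

lemma (in alg_semigroup) alg_semigroup_sub:
  assumes "subsemigroup H S"
  shows "alg_semigroup (S\<lparr>carrier := H\<rparr>)"
  using assms by unfold_locales (auto simp: subsemigroup_def subset_iff m_assoc)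

text \<open>A solution \<open>s\<close> in \<open>S\<close> of \<open>s \<otimes> a = b\<close> with
  \<open>a\<close>, \<open>b\<close> in \<open>H\<close> is forced into \<open>H\<close> by right
  unitarity.\<close>

lemma (in left_simple_semigroup) left_simple_sub:
  assumes H: "subsemigroup H S" and ru: "right_unitary_in H S"
  shows "left_simple_semigroup (S\<lparr>carrier := H\<rparr>)"
proof -
  interpret H: alg_semigroup "S\<lparr>carrier := H\<rparr>"
    by (rule alg_semigroup_sub[OF H])
  show ?thesis
  proof (unfold_locales, simp)
    fix a b assume ab: "a \<in> H" "b \<in> H"
    then obtain s where s: "s \<in> carrier S" "s \<otimes> a = b"
      using left_simple H unfolding subsemigroup_def by (meson subsetD)
    then have "s \<in> H"
      using ru ab H unfolding right_unitary_in_def subsemigroup_def by blast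
    then show "\<exists>s\<in>H. s \<otimes> a = b"
      using s by blast
  qed
qed

text \<open>Inverses come from solving two equations: \<open>s \<otimes> a = a\<close> makes
  \<open>f s\<close> the identity, and then \<open>t \<otimes> a = s\<close> makes
  \<open>f t\<close> the inverse of \<open>f a\<close>.\<close>

lemma (in left_simple_semigroup) subgroup_hom_image:
  assumes "group G" and f: "f \<in> hom S G" and ne: "carrier S \<noteq> {}"
  shows "subgroup (f ` carrier S) G"
proof -
  interpret G: group G by fact
  have fc: "f x \<in> carrier G" if "x \<in> carrier S" for x
    using f that by (auto simp: hom_def)
  have fm: "f (x \<otimes> y) = f x \<otimes>\<^bsub>G\<^esub> f y" if "x \<in> carrier S" "y \<in> carrier S" for x y
    using f that by (auto simp: hom_def)
  have inv: "\<exists>t\<in>carrier S. f t = inv\<^bsub>G\<^esub> f a" if a: "a \<in> carrier S" for a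
  proof -
    obtain s where s: "s \<in> carrier S" "s \<otimes> a = a"
      using left_simple a by blast
    then have "f s \<otimes>\<^bsub>G\<^esub> f a = f a"
      using fm[of s a] a by simp
    then have fs: "f s = \<one>\<^bsub>G\<^esub>"
      using G.r_cancel_one fc a s by simp
    obtain t where t: "t \<in> carrier S" "t \<otimes> a = s"
      using left_simple a s by blast
    then have "f t \<otimes>\<^bsub>G\<^esub> f a = \<one>\<^bsub>G\<^esub>"
      using fm[of t a] a fs by simp
    then have "f t = inv\<^bsub>G\<^esub> f a"
      using G.inv_equality[of "f t" "f a"] fc a t by simp
    then show ?thesis
      using t by blast
  qed
  show ?thesis
  proof (rule G.subgroupI)
    fix g assume "g \<in> f ` carrier S"
    then show "inv\<^bsub>G\<^esub> g \<in> f ` carrier S"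
      using inv by (auto simp: image_iff) metis
  next
    fix g h assume "g \<in> f ` carrier S" "h \<in> f ` carrier S"
    then show "g \<otimes>\<^bsub>G\<^esub> h \<in> f ` carrier S"
      by (auto simp: fm[symmetric] m_closed)
  qed (use ne fc in auto)
qed

lemma (in left_simple_semigroup) subgroup_hom_image_sub:
  assumes "group G" and f: "f \<in> hom S G"
    and L: "subsemigroup L S" "left_simple_semigroup (S\<lparr>carrier := L\<rparr>)"
  shows "subgroup (f ` L) G"
proof -
  have "f \<in> hom (S\<lparr>carrier := L\<rparr>) G"
    using f L(1) unfolding hom_def subsemigroup_def by (auto simp: Pi_def subset_iff)
  then show ?thesis
    using left_simple_semigroup.subgroup_hom_image[OF L(2) assms(1)] L(1)
    unfolding subsemigroup_def by simp
qed

section \<open>The canonical map onto a factor group and two isomorphism theorems\<close>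

definition factor_class :: "('a, 'b) monoid_scheme \<Rightarrow> 'a set \<Rightarrow> 'a \<Rightarrow> 'a set" where
  "factor_class T H x = principal_congruence T H `` {x}"

lemma (in alg_semigroup) factor_class_hom:
  "factor_class S H \<in> hom S (factor_semigroup S H)"
  by (auto simp: hom_def factor_class_def factor_semigroup_mult_class)
    (simp add: factor_semigroup_def quotientI)

lemma factor_class_image: "factor_class S H ` carrier S = carrier (factor_semigroup S H)"
  by (auto simp: factor_class_def factor_semigroup_def quotient_def)

text \<open>The identity is the set \<open>H\<close> by definition. As the factor is a group,
  \<open>H\<close> lies in its carrier and so is a congruence class; \<open>x\<close> belongs to it
  exactly when its own class is \<open>H\<close>.\<close>

lemma (in left_simple_semigroup) factor_class_eq_one_iff:
  assumes H: "reflexive_unitary_subsemigroup H S" and x: "x \<in> carrier S"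
  shows "factor_class S H x = \<one>\<^bsub>factor_semigroup S H\<^esub> \<longleftrightarrow> x \<in> H"
proof -
  interpret F: group "factor_semigroup S H"
    by (rule factor_semigroup_group[OF H])
  have "H \<in> carrier S // principal_congruence S H"
    using F.one_closed by (simp add: factor_semigroup_def)
  then obtain a where a: "a \<in> carrier S" "H = principal_congruence S H `` {a}"
    by (auto simp: quotient_def)
  have "factor_class S H x = H \<longleftrightarrow> (a, x) \<in> principal_congruence S H"
    using eq_equiv_class_iff[OF equiv_principal_congruence a(1) x] a(2)
    unfolding factor_class_def by metis
  also have "\<dots> \<longleftrightarrow> x \<in> H"
    using a(2) by (metis Image_singleton_iff)
  finally show ?thesis
    by (simp add: factor_semigroup_def)
qed

text \<open>First isomorphism theorem: the principal congruence of the kernel relates exactly the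
  elements with equal images under \<open>f\<close>.\<close>

lemma (in alg_semigroup) factor_semigroup_kernel_iso:
  assumes "group G" and f: "f \<in> hom S G" and surj: "f ` carrier S = carrier G"
    and K: "K = {x \<in> carrier S. f x = \<one>\<^bsub>G\<^esub>}"
  shows "G \<cong> factor_semigroup S K"
proof -
  interpret G: group G by fact
  let ?P = "principal_congruence S K" and ?F = "factor_semigroup S K"
  \<comment> \<open>The isomorphism runs from \<open>G\<close> to the factor and sends
    \<open>g\<close> to its fibre, so its definition needs no representatives.\<close>
  let ?h = "\<lambda>g. {x \<in> carrier S. f x = g}"
  have fc: "f x \<in> carrier G" if "x \<in> carrier S" for x
    using f that by (auto simp: hom_def)
  have fm: "f (x \<otimes> y) = f x \<otimes>\<^bsub>G\<^esub> f y" if "x \<in> carrier S" "y \<in> carrier S" for x y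
    using f that by (auto simp: hom_def)
  have P: "(a, b) \<in> ?P \<longleftrightarrow> f a = f b" if ab: "a \<in> carrier S" "b \<in> carrier S" for a b
  proof
    assume P: "(a, b) \<in> ?P"
    \<comment> \<open>The context \<open>s\<close>, \<open>t\<close> is chosen over the inverse of
      \<open>f a\<close> and the identity: it carries \<open>a\<close> into \<open>K\<close>, and
      carries \<open>b\<close> there only if the images agree.\<close>
    have "inv\<^bsub>G\<^esub> f a \<in> f ` carrier S" "\<one>\<^bsub>G\<^esub> \<in> f ` carrier S"
      using surj fc ab by auto
    then obtain s t where st: "s \<in> carrier S" "f s = inv\<^bsub>G\<^esub> f a" "t \<in> carrier S" "f t = \<one>\<^bsub>G\<^esub>"
      by (metis imageE)
    then have "s \<otimes> a \<otimes> t \<in> K"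
      using ab fc by (simp add: K fm m_closed)
    then have "s \<otimes> b \<otimes> t \<in> K"
      using P st unfolding principal_congruence_def by blast
    then have "inv\<^bsub>G\<^esub> f a \<otimes>\<^bsub>G\<^esub> f b = \<one>\<^bsub>G\<^esub>"
      using ab fc st by (simp add: K fm m_closed)
    then show "f a = f b"
      using G.inv_solve_left[of "\<one>\<^bsub>G\<^esub>" "f a" "f b"] ab fc by simp
  next
    assume "f a = f b"
    then show "(a, b) \<in> ?P"
      using ab by (auto simp: principal_congruence_def K fm m_closed)
  qed
  have h: "?h (f a) = ?P `` {a}" if "a \<in> carrier S" for a
  proof -
    have "?P `` {a} = {x \<in> carrier S. (a, x) \<in> ?P}"
      by (auto simp: principal_congruence_def)
    then show ?thesis
      using P[OF that] by auto
  qed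
  have onto: "\<exists>a\<in>carrier S. g = f a" if "g \<in> carrier G" for g
    using surj that by blast
  have "?h \<in> iso G ?F"
  proof (rule isoI)
    show "?h \<in> hom G ?F"
    proof (rule homI)
      fix g assume "g \<in> carrier G"
      then obtain a where "a \<in> carrier S" "g = f a" using onto by blast
      then show "?h g \<in> carrier ?F"
        by (simp add: h factor_semigroup_def quotientI)
    next
      fix g g' assume "g \<in> carrier G" "g' \<in> carrier G"
      then obtain a b where ab: "a \<in> carrier S" "g = f a" "b \<in> carrier S" "g' = f b"
        using onto by meson
      then show "?h (g \<otimes>\<^bsub>G\<^esub> g') = ?h g \<otimes>\<^bsub>?F\<^esub> ?h g'"
        using h[of "a \<otimes> b"] by (simp add: h fm m_closed factor_semigroup_mult_class)
    qed
    have "inj_on ?h (carrier G)"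
      using onto by (intro inj_onI) blast
    moreover have "?h ` carrier G = carrier ?F"
      using h by (force simp: surj[symmetric] factor_semigroup_def quotient_def image_iff)
    ultimately show "bij_betw ?h (carrier G) (carrier ?F)"
      by (simp add: bij_betw_def)
  qed
  then show ?thesis
    by (rule is_isoI)
qed

text \<open>Second isomorphism theorem; \<open>cover\<close> replaces the condition
  \<open>S = W H\<close> of groups. It makes each class the inverse of the class of some element of
  \<open>W\<close>. The classes of elements of \<open>W\<close> form a subgroup, so \<open>W\<close>
  maps onto the whole factor, with kernel \<open>W \<inter> H\<close>.\<close>

lemma (in left_simple_semigroup) factor_semigroup_sub_iso:
  assumes H: "reflexive_unitary_subsemigroup H S"
    and W: "subsemigroup W S" "left_simple_semigroup (S\<lparr>carrier := W\<rparr>)"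
    and cover: "\<And>x. x \<in> carrier S \<Longrightarrow> \<exists>w\<in>W. w \<otimes> x \<in> H"
  shows "factor_semigroup S H \<cong> factor_semigroup (S\<lparr>carrier := W\<rparr>) (W \<inter> H)"
proof -
  let ?F = "factor_semigroup S H"
  interpret F: group ?F
    by (rule factor_semigroup_group[OF H])
  interpret W: left_simple_semigroup "S\<lparr>carrier := W\<rparr>" by fact
  have WS: "W \<subseteq> carrier S"
    using W(1) by (simp add: subsemigroup_def)
  interpret I: subgroup "factor_class S H ` W" ?F
    by (rule subgroup_hom_image_sub[OF F.is_group factor_class_hom W])
  have c: "factor_class S H x \<in> carrier ?F" if "x \<in> carrier S" for x
    using factor_class_hom that by (auto simp: hom_def)
  have "factor_class S H x \<in> factor_class S H ` W" if x: "x \<in> carrier S" for x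
  proof -
    obtain w where w: "w \<in> W" "w \<otimes> x \<in> H" using cover x by blast
    then have "factor_class S H w \<otimes>\<^bsub>?F\<^esub> factor_class S H x = \<one>\<^bsub>?F\<^esub>"
      using hom_mult[OF factor_class_hom, of w x H] factor_class_eq_one_iff[OF H, of "w \<otimes> x"]
        WS x m_closed[of w x] by (simp add: subset_iff)
    then have "factor_class S H x = inv\<^bsub>?F\<^esub> factor_class S H w"
      using F.inv_solve_left[of "factor_class S H x" "factor_class S H w" "\<one>\<^bsub>?F\<^esub>"] c WS w x
      by (simp add: subset_iff)
    then show ?thesis
      using I.m_inv_closed w by simp
  qed
  then have "factor_class S H ` carrier S = factor_class S H ` W"
    using WS by blast
  then have img: "factor_class S H ` W = carrier ?F"
    by (simp add: factor_class_image)
  have hom: "factor_class S H \<in> hom (S\<lparr>carrier := W\<rparr>) ?F"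
  proof (rule homI)
    fix x assume "x \<in> carrier (S\<lparr>carrier := W\<rparr>)"
    then show "factor_class S H x \<in> carrier ?F"
      using c WS by (simp add: subset_iff)
  next
    fix x y assume "x \<in> carrier (S\<lparr>carrier := W\<rparr>)" "y \<in> carrier (S\<lparr>carrier := W\<rparr>)"
    then show "factor_class S H (x \<otimes>\<^bsub>S\<lparr>carrier := W\<rparr>\<^esub> y) = factor_class S H x \<otimes>\<^bsub>?F\<^esub> factor_class S H y"
      using hom_mult[OF factor_class_hom, of x y] WS by (simp add: subset_iff)
  qed
  have "W \<inter> H = {x \<in> W. factor_class S H x = \<one>\<^bsub>?F\<^esub>}"
    using factor_class_eq_one_iff[OF H] WS by blast
  then show ?thesis
    using W.factor_semigroup_kernel_iso[OF F.is_group hom, of "W \<inter> H"] img by simp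
qed

section \<open>Preimages of images of subsemigroups, in place of products\<close>

text \<open>For a left simple \<open>L\<close> this is the full preimage in \<open>T\<close> of the image of \<open>L\<close> in the group
  \<open>T/P\<^sub>N\<close>: inverses in that image come from elements of \<open>L\<close>.\<close>

definition saturation :: "('a, 'b) monoid_scheme \<Rightarrow> 'a set \<Rightarrow> 'a set \<Rightarrow> 'a set" where
  "saturation T N L = {x \<in> carrier T. \<exists>y\<in>L. y \<otimes>\<^bsub>T\<^esub> x \<in> N}"

text \<open>Turns membership into a statement about a subgroup of a group:
  \<open>y \<otimes> x \<in> N\<close> means that the classes of \<open>x\<close> and
  \<open>y\<close> are inverse to each other.\<close>

lemma (in left_simple_semigroup) saturation_iff:
  assumes N: "reflexive_unitary_subsemigroup N S"
    and L: "subsemigroup L S" "left_simple_semigroup (S\<lparr>carrier := L\<rparr>)"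
    and x: "x \<in> carrier S"
  shows "x \<in> saturation S N L \<longleftrightarrow> factor_class S N x \<in> factor_class S N ` L"
proof -
  let ?F = "factor_semigroup S N"
  interpret F: group ?F
    by (rule factor_semigroup_group[OF N])
  interpret I: subgroup "factor_class S N ` L" ?F
    by (rule subgroup_hom_image_sub[OF F.is_group factor_class_hom L])
  have LS: "L \<subseteq> carrier S"
    using L(1) by (simp add: subsemigroup_def)
  have c: "factor_class S N x \<in> carrier ?F" if "x \<in> carrier S" for x
    using factor_class_hom that by (auto simp: hom_def)
  have "y \<otimes> x \<in> N \<longleftrightarrow> factor_class S N x = inv\<^bsub>?F\<^esub> factor_class S N y" if "y \<in> L" for y
  proof -
    have y: "y \<in> carrier S" using LS that by blast
    then have "y \<otimes> x \<in> N \<longleftrightarrow> factor_class S N y \<otimes>\<^bsub>?F\<^esub> factor_class S N x = \<one>\<^bsub>?F\<^esub>"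
      using hom_mult[OF factor_class_hom, of y x] factor_class_eq_one_iff[OF N, of "y \<otimes> x"] x m_closed
      by auto
    also have "\<dots> \<longleftrightarrow> factor_class S N x = inv\<^bsub>?F\<^esub> factor_class S N y"
      using F.inv_solve_left[of "factor_class S N x" "factor_class S N y" "\<one>\<^bsub>?F\<^esub>"] c[OF y] c[OF x]
      by (simp add: eq_commute)
    finally show ?thesis .
  qed
  then have "x \<in> saturation S N L \<longleftrightarrow> (\<exists>y\<in>L. factor_class S N x = inv\<^bsub>?F\<^esub> factor_class S N y)"
    using x by (auto simp: saturation_def)
  also have "\<dots> \<longleftrightarrow> factor_class S N x \<in> factor_class S N ` L"
  proof
    assume "\<exists>y\<in>L. factor_class S N x = inv\<^bsub>?F\<^esub> factor_class S N y"
    then show "factor_class S N x \<in> factor_class S N ` L"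
      using I.m_inv_closed by auto
  next
    assume "factor_class S N x \<in> factor_class S N ` L"
    then have "inv\<^bsub>?F\<^esub> factor_class S N x \<in> factor_class S N ` L"
      by (rule I.m_inv_closed)
    then obtain y where "y \<in> L" "inv\<^bsub>?F\<^esub> factor_class S N x = factor_class S N y"
      by blast
    then show "\<exists>y\<in>L. factor_class S N x = inv\<^bsub>?F\<^esub> factor_class S N y"
      using F.inv_inv[OF c[OF x]] by metis
  qed
  finally show ?thesis .
qed

text \<open>By \<open>saturation_iff\<close> the set is the preimage of a subgroup, so closure and
  both cancellation laws are computed in the group.\<close>

lemma (in left_simple_semigroup) saturation_sub:
  assumes N: "reflexive_unitary_subsemigroup N S"
    and L: "subsemigroup L S" "left_simple_semigroup (S\<lparr>carrier := L\<rparr>)"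
  shows "subsemigroup (saturation S N L) S" "unitary_in (saturation S N L) S"
    "L \<subseteq> saturation S N L"
proof -
  let ?F = "factor_semigroup S N" and ?f = "factor_class S N"
  interpret F: group ?F
    by (rule factor_semigroup_group[OF N])
  interpret I: subgroup "?f ` L" ?F
    by (rule subgroup_hom_image_sub[OF F.is_group factor_class_hom L])
  note sat = saturation_iff[OF N L]
  have sc: "saturation S N L \<subseteq> carrier S"
    by (auto simp: saturation_def)
  have c: "?f x \<in> carrier ?F" if "x \<in> carrier S" for x
    using factor_class_hom that by (auto simp: hom_def)
  have m: "?f (x \<otimes> y) = ?f x \<otimes>\<^bsub>?F\<^esub> ?f y" if "x \<in> carrier S" "y \<in> carrier S" for x y
    using hom_mult[OF factor_class_hom that] .
  show L_sat: "L \<subseteq> saturation S N L"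
    using sat L(1) unfolding subsemigroup_def by auto
  have "x \<otimes> y \<in> saturation S N L" if "x \<in> saturation S N L" "y \<in> saturation S N L" for x y
    using that sc sat[of x] sat[of y] sat[of "x \<otimes> y"] I.m_closed[of "?f x" "?f y"]
    by (auto simp: m m_closed subset_iff)
  then show "subsemigroup (saturation S N L) S"
    using L_sat sc L(1) unfolding subsemigroup_def by auto
  have "b \<in> saturation S N L"
    if ab: "a \<in> carrier S" "b \<in> carrier S" "a \<otimes> b \<in> saturation S N L" "a \<in> saturation S N L" for a b
  proof -
    have "inv\<^bsub>?F\<^esub> ?f a \<otimes>\<^bsub>?F\<^esub> ?f (a \<otimes> b) \<in> ?f ` L"
      using ab sat m_closed by (intro I.m_closed I.m_inv_closed) auto
    also have "inv\<^bsub>?F\<^esub> ?f a \<otimes>\<^bsub>?F\<^esub> ?f (a \<otimes> b) = ?f b"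
      using c ab by (simp add: m F.m_assoc[symmetric])
    finally show ?thesis
      using sat ab by simp
  qed
  moreover have "a \<in> saturation S N L"
    if ab: "a \<in> carrier S" "b \<in> carrier S" "a \<otimes> b \<in> saturation S N L" "b \<in> saturation S N L" for a b
  proof -
    have "?f (a \<otimes> b) \<otimes>\<^bsub>?F\<^esub> inv\<^bsub>?F\<^esub> ?f b \<in> ?f ` L"
      using ab sat m_closed by (intro I.m_closed I.m_inv_closed) auto
    also have "?f (a \<otimes> b) \<otimes>\<^bsub>?F\<^esub> inv\<^bsub>?F\<^esub> ?f b = ?f a"
      using c ab by (simp add: m F.m_assoc)
    finally show ?thesis
      using sat ab by simp
  qed
  ultimately show "unitary_in (saturation S N L) S"
    unfolding unitary_in_def left_unitary_in_def right_unitary_in_def by blast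
qed

lemma unitary_in_sub:
  assumes "unitary_in H S" "K \<subseteq> carrier S"
  shows "unitary_in H (S\<lparr>carrier := K\<rparr>)"
  using assms by (simp add: unitary_in_def left_unitary_in_def right_unitary_in_def) blast

text \<open>Group analogue: for \<open>M\<close> normal in \<open>L\<close> and \<open>N\<close>
  normal in the whole group, \<open>M N\<close> is normal in \<open>L N\<close>. Closure and
  unitarity hold for preimages of subgroups; reflexivity is transferred from \<open>M\<close> in
  \<open>L\<close> through representatives.\<close>

lemma (in left_simple_semigroup) saturation_reflexive_unitary:
  assumes N: "reflexive_unitary_subsemigroup N S"
    and L: "subsemigroup L S" "left_simple_semigroup (S\<lparr>carrier := L\<rparr>)"
    and M: "reflexive_unitary_subsemigroup M (S\<lparr>carrier := L\<rparr>)"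
  shows "reflexive_unitary_subsemigroup (saturation S N M) (S\<lparr>carrier := saturation S N L\<rparr>)"
proof -
  let ?F = "factor_semigroup S N" and ?f = "factor_class S N"
  interpret F: group ?F
    by (rule factor_semigroup_group[OF N])
  interpret L: left_simple_semigroup "S\<lparr>carrier := L\<rparr>" by fact
  have LS: "L \<subseteq> carrier S" and MsubL: "M \<subseteq> L"
    using L(1) M by (auto simp: subsemigroup_def reflexive_unitary_subsemigroup_def)
  have M1: "subsemigroup M S"
    using M LS unfolding reflexive_unitary_subsemigroup_def subsemigroup_def by auto
  have M2: "left_simple_semigroup (S\<lparr>carrier := M\<rparr>)"
    using L.left_simple_sub[of M] M
    by (simp add: reflexive_unitary_subsemigroup_def unitary_in_def)
  interpret I: subgroup "?f ` M" ?F
    by (rule subgroup_hom_image_sub[OF F.is_group factor_class_hom M1 M2])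
  have c: "?f x \<in> carrier ?F" if "x \<in> carrier S" for x
    using factor_class_hom that by (auto simp: hom_def)
  have m: "?f (x \<otimes> y) = ?f x \<otimes>\<^bsub>?F\<^esub> ?f y" if "x \<in> carrier S" "y \<in> carrier S" for x y
    using hom_mult[OF factor_class_hom that] .
  have sub: "saturation S N M \<subseteq> saturation S N L"
    using MsubL by (auto simp: saturation_def)
  have sc: "saturation S N L \<subseteq> carrier S"
    by (auto simp: saturation_def)
  have refl: "y \<otimes> x \<in> saturation S N M"
    if x: "x \<in> saturation S N L" and y: "y \<in> saturation S N L"
      and xy: "x \<otimes> y \<in> saturation S N M" for x y
  proof -
    have xyS: "x \<in> carrier S" "y \<in> carrier S"
      using x y sc by auto
    obtain l where l: "l \<in> L" "?f y = ?f l"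
      using saturation_iff[OF N L xyS(2)] y by blast
    obtain u where u: "u \<in> M" "?f (x \<otimes> y) = ?f u"
      using saturation_iff[OF N M1 M2, of "x \<otimes> y"] xy xyS m_closed by blast
    obtain e where e: "e \<in> M" "?f e = \<one>\<^bsub>?F\<^esub>"
      using I.one_closed by (metis imageE)
    \<comment> \<open>\<open>t\<close> represents the inverse of the class of \<open>l\<close>,
      which is the class of \<open>y\<close>. Hence \<open>l \<otimes> u \<otimes> t\<close>
      represents the conjugate of \<open>x \<otimes> y\<close> by \<open>y\<close>, that is,
      \<open>y \<otimes> x\<close>.\<close>
    obtain t where t: "t \<in> L" "t \<otimes> l = e"
      using L.left_simple[of l e] l e MsubL by auto
    have ltu: "l \<in> carrier S" "t \<in> carrier S" "u \<in> carrier S"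
      using l t u MsubL LS by auto
    have "t \<otimes> (l \<otimes> u) \<in> M"
      using t e u M1 ltu by (simp add: m_assoc[symmetric] subsemigroup_def)
    moreover have "l \<otimes> u \<in> L"
      using l u MsubL L(1) by (auto simp: subsemigroup_def)
    ultimately have "l \<otimes> u \<otimes> t \<in> M"
      using M t by (simp add: reflexive_unitary_subsemigroup_def reflexive_in_def)
    moreover have "?f (l \<otimes> u \<otimes> t) = ?f (y \<otimes> x)"
    proof -
      have "?f t \<otimes>\<^bsub>?F\<^esub> ?f l = \<one>\<^bsub>?F\<^esub>"
        using m[of t l] ltu t e by simp
      then have "?f l \<otimes>\<^bsub>?F\<^esub> ?f t = \<one>\<^bsub>?F\<^esub>"
        using F.inv_comm c ltu by blast
      moreover have "?f (l \<otimes> u \<otimes> t) = ?f l \<otimes>\<^bsub>?F\<^esub> (?f x \<otimes>\<^bsub>?F\<^esub> ?f l) \<otimes>\<^bsub>?F\<^esub> ?f t"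
        using ltu xyS m[of x y] u l by (simp add: m m_closed)
      ultimately show ?thesis
        using ltu xyS c l by (simp add: m F.m_assoc)
    qed
    ultimately show ?thesis
      using saturation_iff[OF N M1 M2, of "y \<otimes> x"] xyS m_closed by (metis imageI)
  qed
  show ?thesis
    using refl sub saturation_sub(1)[OF N M1 M2]
      unitary_in_sub[OF saturation_sub(2)[OF N M1 M2] sc]
    by (simp add: reflexive_unitary_subsemigroup_def subsemigroup_def reflexive_in_def)
qed

section \<open>Normal chains and cancellation in their members\<close>

text \<open>Normal series continued indefinitely, so that indices need no upper bound.\<close>

locale normal_chain = left_simple_semigroup S for S (structure) +
  fixes A :: "nat \<Rightarrow> _ set"
  assumes chain_0: "A 0 = carrier S"
    and chain_Suc: "reflexive_unitary_subsemigroup (A (Suc i)) (S\<lparr>carrier := A i\<rparr>)"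
begin

text \<open>Right unitarity in all of \<open>S\<close> passes down the chain: a factor is first
  pulled into \<open>A i\<close> and then, inside it, into \<open>A (Suc i)\<close>. This is what
  makes every member left simple.\<close>

lemma chain_sub: "subsemigroup (A i) S \<and> right_unitary_in (A i) S"
proof (induction i)
  case 0
  show ?case
  \<comment> \<open>An empty carrier is impossible, since \<open>A (Suc 0)\<close> is a non-empty
    subset of it.\<close>
  proof (cases "carrier S = {}")
    case True
    then show ?thesis
      using chain_Suc[of 0] chain_0
      by (auto simp: reflexive_unitary_subsemigroup_def subsemigroup_def)
  next
    case False
    then show ?thesis
      using chain_0 m_closed by (auto simp: subsemigroup_def right_unitary_in_def)
  qed
next
  case (Suc i)
  have H: "subsemigroup (A (Suc i)) (S\<lparr>carrier := A i\<rparr>)"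
    "right_unitary_in (A (Suc i)) (S\<lparr>carrier := A i\<rparr>)"
    using chain_Suc[of i] by (simp_all add: reflexive_unitary_subsemigroup_def unitary_in_def)
  have sub: "A (Suc i) \<subseteq> A i"
    using H(1) by (simp add: subsemigroup_def)
  have "subsemigroup (A (Suc i)) S"
    using H(1) Suc.IH by (auto simp: subsemigroup_def)
  moreover have "a \<in> A (Suc i)"
    if ab: "a \<in> carrier S" "b \<in> carrier S" "a \<otimes> b \<in> A (Suc i)" "b \<in> A (Suc i)" for a b
  proof -
    have "a \<in> A i"
      using Suc.IH ab sub unfolding right_unitary_in_def by blast
    then show ?thesis
      using H(2) ab sub by (simp add: right_unitary_in_def) (metis subsetD)
  qed
  ultimately show ?case
    by (simp add: right_unitary_in_def)
qed

lemma chain_left_simple: "left_simple_semigroup (S\<lparr>carrier := A i\<rparr>)"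
  by (rule left_simple_sub) (simp_all add: chain_sub)

lemma chain_Suc_subset: "A (Suc i) \<subseteq> A i"
  using chain_Suc[of i] by (simp add: reflexive_unitary_subsemigroup_def subsemigroup_def)

lemma chain_antimono: "i \<le> j \<Longrightarrow> A j \<subseteq> A i"
  using chain_Suc_subset by (rule lift_Suc_antimono_le)

lemma chain_cancel_right:
  assumes "a \<in> A i" "b \<in> A (Suc i)" "a \<otimes> b \<in> A (Suc i)"
  shows "a \<in> A (Suc i)"
proof -
  have "right_unitary_in (A (Suc i)) (S\<lparr>carrier := A i\<rparr>)"
    using chain_Suc[of i] by (simp add: reflexive_unitary_subsemigroup_def unitary_in_def)
  then have "\<forall>a\<in>A i. \<forall>b\<in>A i. a \<otimes> b \<in> A (Suc i) \<and> b \<in> A (Suc i) \<longrightarrow> a \<in> A (Suc i)"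
    by (simp (no_asm_use) add: right_unitary_in_def)
  then show ?thesis
    using assms chain_Suc_subset by blast
qed

lemma chain_cancel_left:
  assumes "a \<in> A (Suc i)" "b \<in> A i" "a \<otimes> b \<in> A (Suc i)"
  shows "b \<in> A (Suc i)"
proof -
  have "left_unitary_in (A (Suc i)) (S\<lparr>carrier := A i\<rparr>)"
    using chain_Suc[of i] by (simp add: reflexive_unitary_subsemigroup_def unitary_in_def)
  then have "\<forall>a\<in>A i. \<forall>b\<in>A i. a \<otimes> b \<in> A (Suc i) \<and> a \<in> A (Suc i) \<longrightarrow> b \<in> A (Suc i)"
    by (simp (no_asm_use) add: left_unitary_in_def)
  then show ?thesis
    using assms chain_Suc_subset by blast
qed

lemma chain_commute:
  assumes "a \<in> A i" "b \<in> A i" "a \<otimes> b \<in> A (Suc i)"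
  shows "b \<otimes> a \<in> A (Suc i)"
  using chain_Suc[of i] assms
  by (simp add: reflexive_unitary_subsemigroup_def reflexive_in_def)

text \<open>Left simplicity and reflexivity give a \<open>t\<close> with
  \<open>a \<otimes> t\<close> in \<open>A (Suc i)\<close>. Since \<open>s\<close> fixes this
  product from the left, right unitarity puts \<open>s\<close> into
  \<open>A (Suc i)\<close>.\<close>

lemma chain_left_identity:
  assumes s: "s \<in> carrier S" and a: "a \<in> A i" and sa: "s \<otimes> a = a"
  shows "s \<in> A (Suc i)"
proof -
  interpret Ai: left_simple_semigroup "S\<lparr>carrier := A i\<rparr>"
    by (rule chain_left_simple)
  have AS: "A i \<subseteq> carrier S" using chain_sub by (simp add: subsemigroup_def)
  have sA: "s \<in> A i"
    using chain_sub[of i] s a sa AS unfolding right_unitary_in_def by (metis subsetD)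
  obtain h where h: "h \<in> A (Suc i)"
    using chain_sub[of "Suc i"] by (auto simp: subsemigroup_def)
  then have hA: "h \<in> A i"
    using chain_Suc_subset[of i] by auto
  obtain t where t: "t \<in> A i" "t \<otimes> a = h"
    using Ai.left_simple[of a h] a hA by auto
  have a_t: "a \<otimes> t \<in> A (Suc i)"
    using chain_commute[of t i a] t a h by simp
  have "s \<otimes> (a \<otimes> t) = a \<otimes> t"
    using s a t AS sa by (metis m_assoc subsetD)
  then show ?thesis
    using chain_cancel_right[OF sA a_t] a_t by simp
qed

end

section \<open>Intersections of two chains\<close>

locale two_chains = A: normal_chain S A + B: normal_chain S B
  for S (structure) and A B
begin

lemma swap: "two_chains S B A"
  by unfold_locales

text \<open>Induction along the diagonal: for a common element \<open>a\<close> of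
  \<open>A m\<close> and \<open>B m\<close>, a solution of \<open>s \<otimes> a = a\<close> lies in
  both next members. Other index pairs follow because the chains decrease.\<close>

lemma inter_nonempty: "A i \<inter> B j \<noteq> {}"
proof -
  have "A m \<inter> B m \<noteq> {}" for m
  proof (induction m)
    case 0
    then show ?case
      using A.chain_0 B.chain_0 A.chain_sub[of 0] by (auto simp: subsemigroup_def)
  next
    case (Suc m)
    then obtain a where a: "a \<in> A m" "a \<in> B m" by blast
    then have "a \<in> carrier S"
      using A.chain_sub[of m] by (auto simp: subsemigroup_def)
    then obtain s where "s \<in> carrier S" "s \<otimes> a = a"
      using A.left_simple by blast
    then show ?case
      using a A.chain_left_identity B.chain_left_identity by blast
  qed
  moreover have "A (max i j) \<inter> B (max i j) \<subseteq> A i \<inter> B j"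
    using A.chain_antimono[of i "max i j"] B.chain_antimono[of j "max i j"] by auto
  ultimately show ?thesis by blast
qed

lemma inter_sub: "subsemigroup (A i \<inter> B j) S" "right_unitary_in (A i \<inter> B j) S"
proof -
  show "subsemigroup (A i \<inter> B j) S"
    using A.chain_sub[of i] B.chain_sub[of j] inter_nonempty[of i j]
    by (auto simp: subsemigroup_def)
  show "right_unitary_in (A i \<inter> B j) S"
    using A.chain_sub[of i] B.chain_sub[of j] unfolding right_unitary_in_def by blast
qed

lemma inter_left_simple: "left_simple_semigroup (S\<lparr>carrier := A i \<inter> B j\<rparr>)"
  by (rule A.left_simple_sub) (rule inter_sub)+

lemma inter_Suc:
  "reflexive_unitary_subsemigroup (A i \<inter> B (Suc j)) (S\<lparr>carrier := A i \<inter> B j\<rparr>)"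
  unfolding reflexive_unitary_subsemigroup_def
proof (intro conjI)
  show "subsemigroup (A i \<inter> B (Suc j)) (S\<lparr>carrier := A i \<inter> B j\<rparr>)"
    using inter_sub(1)[of i "Suc j"] B.chain_Suc_subset[of j]
    by (auto simp: subsemigroup_def)
  have Am: "x \<otimes> y \<in> A i" if "x \<in> A i" "y \<in> A i" for x y
    using A.chain_sub[of i] that by (simp add: subsemigroup_def)
  show "reflexive_in (A i \<inter> B (Suc j)) (S\<lparr>carrier := A i \<inter> B j\<rparr>)"
    using B.chain_commute Am by (simp add: reflexive_in_def)
  show "unitary_in (A i \<inter> B (Suc j)) (S\<lparr>carrier := A i \<inter> B j\<rparr>)"
    unfolding unitary_in_def
  proof
    show "left_unitary_in (A i \<inter> B (Suc j)) (S\<lparr>carrier := A i \<inter> B j\<rparr>)"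
      unfolding left_unitary_in_def by (auto intro: B.chain_cancel_left)
    show "right_unitary_in (A i \<inter> B (Suc j)) (S\<lparr>carrier := A i \<inter> B j\<rparr>)"
      unfolding right_unitary_in_def by (auto intro: B.chain_cancel_right)
  qed
qed

end

section \<open>Schreier terms and Zassenhaus' lemma\<close>

text \<open>In groups this is the product of \<open>A (Suc i)\<close> and
  \<open>A i \<inter> B j\<close>; for fixed \<open>i\<close> it descends from \<open>A i\<close>
  towards \<open>A (Suc i)\<close> as \<open>j\<close> grows.\<close>

definition schreier_term ::
  "('a, 'b) monoid_scheme \<Rightarrow> (nat \<Rightarrow> 'a set) \<Rightarrow> (nat \<Rightarrow> 'a set) \<Rightarrow> nat \<Rightarrow> nat \<Rightarrow> 'a set" where
  "schreier_term S A B i j = saturation (S\<lparr>carrier := A i\<rparr>) (A (Suc i)) (A i \<inter> B j)"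

context two_chains
begin

lemma inter_sub_A: "subsemigroup (A i \<inter> B j) (S\<lparr>carrier := A i\<rparr>)"
  using inter_sub(1)[of i j] by (auto simp: subsemigroup_def)

lemma schreier_term_Suc:
  "reflexive_unitary_subsemigroup (schreier_term S A B i (Suc j))
     (S\<lparr>carrier := schreier_term S A B i j\<rparr>)"
  using left_simple_semigroup.saturation_reflexive_unitary[OF A.chain_left_simple A.chain_Suc inter_sub_A]
    inter_left_simple inter_Suc by (simp add: schreier_term_def)

lemma schreier_term_sub:
  "subsemigroup (schreier_term S A B i j) S"
  "left_simple_semigroup (S\<lparr>carrier := schreier_term S A B i j\<rparr>)"
  "A i \<inter> B j \<subseteq> schreier_term S A B i j"
proof -
  note sat = left_simple_semigroup.saturation_sub[OF A.chain_left_simple A.chain_Suc inter_sub_A,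
      of i j, simplified, OF inter_left_simple, folded schreier_term_def]
  show "A i \<inter> B j \<subseteq> schreier_term S A B i j"
    by (rule sat)
  show "subsemigroup (schreier_term S A B i j) S"
    using sat(1) A.chain_sub[of i] by (auto simp: subsemigroup_def)
  show "left_simple_semigroup (S\<lparr>carrier := schreier_term S A B i j\<rparr>)"
    using left_simple_semigroup.left_simple_sub[OF A.chain_left_simple sat(1)] sat(2)
    by (simp add: unitary_in_def)
qed

text \<open>As \<open>B 0\<close> is all of \<open>S\<close>, the condition on \<open>x\<close> only
  asks for some \<open>y\<close> in \<open>A i\<close> with \<open>y \<otimes> x\<close> in
  \<open>A (Suc i)\<close>, and left simplicity of \<open>A i\<close> solves for any such
  target.\<close>

lemma schreier_term_0: "schreier_term S A B i 0 = A i"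
proof -
  interpret Ai: left_simple_semigroup "S\<lparr>carrier := A i\<rparr>"
    by (rule A.chain_left_simple)
  have sub: "A i \<subseteq> B 0"
    using A.chain_sub[of i] B.chain_0 by (simp add: subsemigroup_def)
  obtain h where "h \<in> A (Suc i)" "h \<in> A i"
    using A.chain_sub[of "Suc i"] A.chain_Suc_subset[of i] by (auto simp: subsemigroup_def)
  then have "\<exists>y\<in>A i. y \<otimes> x \<in> A (Suc i)" if "x \<in> A i" for x
    using Ai.left_simple[of x h] that by auto
  then show ?thesis
    using sub by (auto simp: schreier_term_def saturation_def Int_absorb2)
qed

text \<open>The common end makes \<open>A i \<inter> B N\<close> equal to \<open>A N\<close>, a
  subset of \<open>A (Suc i)\<close>. Left multiplication by its elements neither leaves
  \<open>A (Suc i)\<close>, by closure, nor enters it from the rest of \<open>A i\<close>, by left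
  unitarity.\<close>

lemma schreier_term_end:
  assumes "A N = B N" "i < N"
  shows "schreier_term S A B i N = A (Suc i)"
proof -
  have "A i \<inter> B N = A N" and sub: "A N \<subseteq> A (Suc i)" "A (Suc i) \<subseteq> A i"
    using A.chain_antimono[of i N] A.chain_antimono[of "Suc i" N] A.chain_Suc_subset[of i] assms
    by auto
  then have eq: "schreier_term S A B i N = {x \<in> A i. \<exists>y\<in>A N. y \<otimes> x \<in> A (Suc i)}"
    by (simp add: schreier_term_def saturation_def)
  have "x \<in> A (Suc i)" if "x \<in> A i" "y \<in> A N" "y \<otimes> x \<in> A (Suc i)" for x y
    using A.chain_cancel_left that sub by blast
  moreover have "\<exists>y\<in>A N. y \<otimes> x \<in> A (Suc i)" if x: "x \<in> A (Suc i)" for x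
  proof -
    obtain y where y: "y \<in> A N"
      using A.chain_sub[of N] by (auto simp: subsemigroup_def)
    then have "y \<otimes> x \<in> A (Suc i)"
      using A.chain_sub[of "Suc i"] x sub by (auto simp: subsemigroup_def)
    then show ?thesis
      using y by blast
  qed
  ultimately show ?thesis
    using eq sub by auto
qed

text \<open>In groups the left-hand side is the product of \<open>A (Suc i) \<inter> B j\<close> and
  \<open>A i \<inter> B (Suc j)\<close>, which is symmetric in the two chains. Together with its
  mirror image the inclusion expresses this symmetry.\<close>

lemma inter_schreier_term_subset:
  "A i \<inter> B j \<inter> schreier_term S A B i (Suc j) \<subseteq> schreier_term S B A j (Suc i)"
proof
  fix x assume x: "x \<in> A i \<inter> B j \<inter> schreier_term S A B i (Suc j)"
  then obtain y where y: "y \<in> A i" "y \<in> B (Suc j)" "y \<otimes> x \<in> A (Suc i)"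
    by (auto simp: schreier_term_def saturation_def)
  interpret V: left_simple_semigroup "S\<lparr>carrier := A i \<inter> B (Suc j)\<rparr>"
    by (rule inter_left_simple)
  interpret W: left_simple_semigroup "S\<lparr>carrier := A i \<inter> B j\<rparr>"
    by (rule inter_left_simple)
  have sub: "A (Suc i) \<subseteq> A i" "B (Suc j) \<subseteq> B j" "A i \<subseteq> carrier S"
    using A.chain_Suc_subset[of i] B.chain_Suc_subset[of j] A.chain_sub[of i]
    by (auto simp: subsemigroup_def)
  \<comment> \<open>\<open>z\<close> becomes an inverse of \<open>y\<close> modulo
    \<open>A (Suc i)\<close> inside \<open>A i \<inter> B (Suc j)\<close>, by solving
    \<open>z \<otimes> y = e\<close> for a common element \<open>e\<close>.\<close>
  obtain e where "e \<in> A (Suc i)" "e \<in> B (Suc j)"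
    using inter_nonempty by blast
  then obtain z where z: "z \<in> A i" "z \<in> B (Suc j)" "z \<otimes> y \<in> A (Suc i)"
    using V.left_simple[of y e] y sub by auto
  \<comment> \<open>\<open>w\<close> is the witness for the other saturation:
    \<open>w \<otimes> x\<close> is \<open>z\<close>, hence in \<open>B (Suc j)\<close>, and
    \<open>w \<otimes> (x \<otimes> y) = z \<otimes> y\<close> will put \<open>w\<close> into
    \<open>A (Suc i)\<close>.\<close>
  obtain w where w: "w \<in> A i" "w \<in> B j" "w \<otimes> x = z"
    using W.left_simple[of x z] x z sub by auto
  have "x \<otimes> y \<in> A (Suc i)"
    using A.chain_commute x y by blast
  moreover have "w \<otimes> (x \<otimes> y) \<in> A (Suc i)"
    using z w x y sub by (metis A.m_assoc IntE subsetD)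
  ultimately have "w \<in> A (Suc i)"
    using A.chain_cancel_right w by blast
  then show "x \<in> schreier_term S B A j (Suc i)"
    using w z x by (auto simp: schreier_term_def saturation_def)
qed

text \<open>Second isomorphism theorem with \<open>W = A i \<inter> B j\<close>. The covering
  condition is built into the saturation, because \<open>A (Suc i)\<close> is contained in the
  smaller term.\<close>

lemma schreier_factor_iso_inter:
  "factor_semigroup (S\<lparr>carrier := schreier_term S A B i j\<rparr>) (schreier_term S A B i (Suc j))
     \<cong> factor_semigroup (S\<lparr>carrier := A i \<inter> B j\<rparr>) (A i \<inter> B j \<inter> schreier_term S A B i (Suc j))"
proof -
  let ?X = "schreier_term S A B i j" and ?X' = "schreier_term S A B i (Suc j)"
  interpret X: left_simple_semigroup "S\<lparr>carrier := ?X\<rparr>"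
    by (rule schreier_term_sub)
  have "A (Suc i) \<subseteq> ?X'"
  proof
    fix x assume x: "x \<in> A (Suc i)"
    obtain y where y: "y \<in> A (Suc i)" "y \<in> B (Suc j)"
      using inter_nonempty by blast
    then have "y \<otimes> x \<in> A (Suc i)"
      using A.chain_sub[of "Suc i"] x by (simp add: subsemigroup_def)
    then show "x \<in> ?X'"
      using x y A.chain_Suc_subset[of i]
      by (auto simp: schreier_term_def saturation_def subset_iff)
  qed
  then have "\<exists>w\<in>A i \<inter> B j. w \<otimes> x \<in> ?X'" if "x \<in> ?X" for x
    using that by (auto simp: schreier_term_def saturation_def)
  moreover have "subsemigroup (A i \<inter> B j) (S\<lparr>carrier := ?X\<rparr>)"
    using inter_sub(1)[of i j] schreier_term_sub(3)[of i j] by (auto simp: subsemigroup_def)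
  ultimately show ?thesis
    using X.factor_semigroup_sub_iso[OF schreier_term_Suc] inter_left_simple by simp
qed

lemma zassenhaus:
  "factor_semigroup (S\<lparr>carrier := schreier_term S A B i j\<rparr>) (schreier_term S A B i (Suc j))
     \<cong> factor_semigroup (S\<lparr>carrier := schreier_term S B A j i\<rparr>) (schreier_term S B A j (Suc i))"
proof -
  interpret sw: two_chains S B A by (rule swap)
  let ?W = "A i \<inter> B j" and ?D = "A i \<inter> B j \<inter> schreier_term S A B i (Suc j)"
  let ?Y = "factor_semigroup (S\<lparr>carrier := schreier_term S B A j i\<rparr>) (schreier_term S B A j (Suc i))"
  interpret Y: group ?Y
    by (rule left_simple_semigroup.factor_semigroup_group
        [OF sw.schreier_term_sub(2) sw.schreier_term_Suc])
  \<comment> \<open>The inclusion and its mirror image show that the two kernels in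
    \<open>A i \<inter> B j\<close> coincide.\<close>
  have "?D = B j \<inter> A i \<inter> schreier_term S B A j (Suc i)"
    using inter_schreier_term_subset sw.inter_schreier_term_subset by blast
  then have "?Y \<cong> factor_semigroup (S\<lparr>carrier := ?W\<rparr>) ?D"
    using sw.schreier_factor_iso_inter[of j i] by (simp add: Int_commute)
  then have "factor_semigroup (S\<lparr>carrier := ?W\<rparr>) ?D \<cong> ?Y"
    by (rule Y.iso_sym)
  then show ?thesis
    by (rule iso_trans[OF schreier_factor_iso_inter])
qed

end

section \<open>Concatenating the rows of Schreier terms\<close>

text \<open>The terms are listed row by row, index \<open>m\<close> standing for row
  \<open>m div N\<close> and column \<open>m mod N\<close>. Column \<open>N\<close> is omitted,
  because with a common end it equals column 0 of the next row.\<close>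

definition schreier_refinement ::
  "('a, 'b) monoid_scheme \<Rightarrow> (nat \<Rightarrow> 'a set) \<Rightarrow> (nat \<Rightarrow> 'a set) \<Rightarrow> nat \<Rightarrow> nat \<Rightarrow> 'a set" where
  "schreier_refinement S A B N m = schreier_term S A B (m div N) (m mod N)"

context two_chains
begin

text \<open>Lets every step be read inside one row: at the end of a row,
  \<open>schreier_term_end\<close> and \<open>schreier_term_0\<close> identify its column
  \<open>N\<close> with the start of the next row.\<close>

lemma schreier_refinement_Suc:
  assumes AB: "A N = B N" and m: "m < N * N"
  shows "schreier_refinement S A B N (Suc m) = schreier_term S A B (m div N) (Suc (m mod N))"
proof (cases "Suc (m mod N) = N")
  case True
  then have "Suc m mod N = 0" "Suc m div N = Suc (m div N)"
    by (simp_all add: mod_Suc div_Suc)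
  moreover have "m div N < N"
    using m by (simp add: less_mult_imp_div_less)
  ultimately show ?thesis
    using schreier_term_0 schreier_term_end[OF AB, of "m div N"] True
    by (simp add: schreier_refinement_def)
next
  case False
  then show ?thesis
    by (simp add: schreier_refinement_def mod_Suc div_Suc)
qed

lemma normal_series_schreier_refinement:
  assumes AB: "A N = B N"
  shows "normal_series S (schreier_refinement S A B N) (N * N)"
  unfolding normal_series_def
proof (intro conjI ballI)
  show "schreier_refinement S A B N 0 = carrier S"
    using schreier_term_0 A.chain_0 by (simp add: schreier_refinement_def)
  show "subsemigroup (schreier_refinement S A B N i) S" for i
    using schreier_term_sub(1) by (simp add: schreier_refinement_def)
  fix i assume "i \<in> {1..N * N}"
  then obtain m where "i = Suc m" "m < N * N"
    by (cases i) auto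
  then show "reflexive_unitary_subsemigroup (schreier_refinement S A B N i)
      (S\<lparr>carrier := schreier_refinement S A B N (i - 1)\<rparr>)"
    using schreier_refinement_Suc[OF AB] schreier_term_Suc
    by (simp add: schreier_refinement_def)
qed

text \<open>Rows begin with the members of the original chain, which is why the result refines
  it.\<close>

lemma schreier_refinement_mult: "0 < N \<Longrightarrow> schreier_refinement S A B N (i * N) = A i"
  using schreier_term_0 by (simp add: schreier_refinement_def)

lemma isomorphic_schreier_refinements:
  assumes AB: "A N = B N"
  shows "isomorphic_series S (schreier_refinement S A B N) (N * N)
    (schreier_refinement S B A N) (N * N)"
proof -
  interpret sw: two_chains S B A by (rule swap)
  \<comment> \<open>\<open>q\<close> transposes the \<open>N\<close> by \<open>N\<close> grid,
    matching the row and column exchange in \<open>zassenhaus\<close>.\<close>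
  define q where "q m = (m mod N) * N + m div N" for m
  \<comment> \<open>Factors are numbered from 1, so factor \<open>Suc m\<close> belongs to position
    \<open>m\<close>; outside the range \<open>p\<close> must be the identity to be a
    permutation.\<close>
  define p where "p m = (if m \<in> {1..N * N} then Suc (q (m - 1)) else m)" for m
  have q: "q m < N * N \<and> q m div N = m mod N \<and> q m mod N = m div N" if m: "m < N * N" for m
  proof -
    have N: "0 < N" using m by (cases N) auto
    have lt: "m div N < N" "m mod N < N"
      using m N by (auto simp: less_mult_imp_div_less)
    then have "q m < Suc (m mod N) * N"
      by (simp add: q_def)
    also have "\<dots> \<le> N * N"
      using lt by (intro mult_right_mono Suc_leI) auto
    finally show ?thesis
      using lt by (simp add: q_def)
  qed
  then have qq: "q (q m) = m" if "m < N * N" for m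
    using that by (simp add: q_def[of "q m"])
  have pp: "p (p m) = m" for m
  proof (cases "m \<in> {1..N * N}")
    case True
    then have "m - 1 < N * N" by auto
    then show ?thesis
      using True q[of "m - 1"] qq[of "m - 1"] by (auto simp: p_def)
  next
    case False
    then have "p m = m"
      by (simp only: p_def if_False)
    then show ?thesis
      by simp
  qed
  \<comment> \<open>An involution has unique preimages.\<close>
  have "p permutes {1..N * N}"
    unfolding permutes_def using pp by (metis p_def)
  moreover have "series_factor S (schreier_refinement S A B N) i
      \<cong> series_factor S (schreier_refinement S B A N) (p i)" if i: "i \<in> {1..N * N}" for i
  proof -
    obtain m where m: "i = Suc m" "m < N * N"
      using i by (cases i) auto
    then have "p i = Suc (q m)"
      using i by (simp add: p_def)
    then show ?thesis
      using m q[OF m(2)] schreier_refinement_Suc[OF AB m(2)]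
        sw.schreier_refinement_Suc[OF AB[symmetric], of "q m"] zassenhaus[of "m div N" "m mod N"]
      by (simp add: series_factor_def schreier_refinement_def)
  qed
  ultimately show ?thesis
    unfolding isomorphic_series_def by blast
qed

section \<open>Continuing two series to a common end\<close>

text \<open>Up to index \<open>k\<close> truncated subtraction leaves \<open>B 0\<close>, the whole
  carrier, so only \<open>A\<close> moves; from \<open>k\<close> on \<open>A\<close> is constant and
  only \<open>B\<close> moves. Each step is thus a step of one chain intersected with a fixed
  set.\<close>

lemma extended_chain:
  assumes "\<And>i. k \<le> i \<Longrightarrow> A i = A k"
  shows "normal_chain S (\<lambda>i. A i \<inter> B (i - k))"
proof unfold_locales
  interpret sw: two_chains S B A by (rule swap)
  show "A 0 \<inter> B (0 - k) = carrier S"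
    using A.chain_0 B.chain_0 by simp
  fix i
  show "reflexive_unitary_subsemigroup (A (Suc i) \<inter> B (Suc i - k))
      (S\<lparr>carrier := A i \<inter> B (i - k)\<rparr>)"
  proof (cases "i < k")
    case True
    then show ?thesis
      \<comment> \<open>Both \<open>B\<close> indices are 0 here, even for \<open>Suc i = k\<close>;
        the moving chain is \<open>A\<close>, hence the swapped instance.\<close>
      using sw.inter_Suc[of 0 i] by (simp add: Int_commute)
  next
    case False
    then show ?thesis
      using inter_Suc[of i "i - k"] assms[of i] assms[of "Suc i"] by (simp add: Suc_diff_le)
  qed
qed

end

text \<open>After index \<open>k\<close> the chain repeats \<open>A k\<close>, and a subsemigroup is
  reflexive and unitary in itself.\<close>

lemma normal_chain_of_series:
  assumes "left_simple_semigroup S" and A: "normal_series S A k"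
  shows "normal_chain S (\<lambda>i. A (min i k))"
proof -
  interpret left_simple_semigroup S by fact
  have sub: "subsemigroup (A k) S"
    using A by (auto simp: normal_series_def)
  show ?thesis
  proof unfold_locales
    show "A (min 0 k) = carrier S"
      using A by (simp add: normal_series_def)
    fix i
    show "reflexive_unitary_subsemigroup (A (min (Suc i) k)) (S\<lparr>carrier := A (min i k)\<rparr>)"
    proof (cases "i < k")
      case True
      then have "Suc i \<in> {1..k}" by auto
      then have "reflexive_unitary_subsemigroup (A (Suc i)) (S\<lparr>carrier := A (Suc i - 1)\<rparr>)"
        using A unfolding normal_series_def by blast
      then show ?thesis
        using True by simp
    next
      case False
      then show ?thesis
        using sub by (auto simp: reflexive_unitary_subsemigroup_def reflexive_in_def
            unitary_in_def left_unitary_in_def right_unitary_in_def subsemigroup_def min_def)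
    qed
  qed
qed

theorem theorem8:
  fixes S :: "('a, 'b) monoid_scheme"
    and A B :: "nat \<Rightarrow> 'a set"
    and k n :: nat
  assumes "left_simple_semigroup S"
    and "normal_series S A k"
    and "normal_series S B n"
  shows "\<exists>A' k' B' n'.
           normal_series S A' k' \<and> series_refinement A' k' A k \<and>
           normal_series S B' n' \<and> series_refinement B' n' B n \<and>
           isomorphic_series S A' k' B' n'"
proof -
  define A1 where "A1 i = A (min i k)" for i
  define B1 where "B1 i = B (min i n)" for i
  interpret A1: normal_chain S A1
    using normal_chain_of_series[OF assms(1,2)] by (simp add: A1_def[abs_def])
  interpret B1: normal_chain S B1
    using normal_chain_of_series[OF assms(1,3)] by (simp add: B1_def[abs_def])
  interpret one: two_chains S A1 B1 ..
  interpret one': two_chains S B1 A1 ..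
  \<comment> \<open>The members are \<open>A 0\<close>, ..., \<open>A k\<close>, then
    \<open>A k \<inter> B 1\<close>, ..., \<open>A k \<inter> B n\<close>, the last one repeated
    forever.\<close>
  define A2 where "A2 i = A1 i \<inter> B1 (i - k)" for i
  define B2 where "B2 i = B1 i \<inter> A1 (i - n)" for i
  interpret A2: normal_chain S A2
    using one.extended_chain[of k] by (simp add: A2_def[abs_def] A1_def)
  interpret B2: normal_chain S B2
    using one'.extended_chain[of n] by (simp add: B2_def[abs_def] B1_def)
  interpret two: two_chains S A2 B2 ..
  interpret two': two_chains S B2 A2 ..
  \<comment> \<open>At index \<open>k + n\<close> both extended chains have arrived at
    \<open>A k \<inter> B n\<close>.\<close>
  define N where "N = k + n"
  have AB: "A2 N = B2 N"
    by (auto simp: A2_def B2_def A1_def B1_def N_def)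
  have A2: "A2 i = A i" if "i \<le> k" for i
    using that B1.chain_0 A1.chain_sub[of i] by (auto simp: A2_def A1_def subsemigroup_def)
  have B2: "B2 i = B i" if "i \<le> n" for i
    using that A1.chain_0 B1.chain_sub[of i] by (auto simp: B2_def B1_def subsemigroup_def)
  \<comment> \<open>Row \<open>i\<close> starts at \<open>i * N\<close>. As \<open>i \<ge> 1\<close>
    forces \<open>N > 0\<close>, this index is positive, and \<open>i = N\<close> still meets the
    closed upper bound.\<close>
  have in_range: "i * N \<in> {1..N * N}" if "i \<in> {1..k} \<or> i \<in> {1..n}" for i
    using that by (auto simp: N_def)
  have len: "k \<le> N * N" "n \<le> N * N"
    by (auto simp: N_def algebra_simps intro: le_square trans_le_add1 trans_le_add2)
  have "series_refinement (schreier_refinement S A2 B2 N) (N * N) A k"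
    unfolding series_refinement_def
  proof (intro conjI ballI len)
    fix i assume i: "i \<in> {1..k}"
    then show "\<exists>j\<in>{1..N * N}. A i = schreier_refinement S A2 B2 N j"
      using two.schreier_refinement_mult[of N i] A2[of i] in_range[of i]
      by (intro bexI[of _ "i * N"]) (auto simp: N_def)
  qed
  moreover have "series_refinement (schreier_refinement S B2 A2 N) (N * N) B n"
    unfolding series_refinement_def
  proof (intro conjI ballI len)
    fix i assume i: "i \<in> {1..n}"
    then show "\<exists>j\<in>{1..N * N}. B i = schreier_refinement S B2 A2 N j"
      using two'.schreier_refinement_mult[of N i] B2[of i] in_range[of i]
      by (intro bexI[of _ "i * N"]) (auto simp: N_def)
  qed
  ultimately show ?thesis
    using two.normal_series_schreier_refinement[OF AB]
      two'.normal_series_schreier_refinement[OF AB[symmetric]]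
      two.isomorphic_schreier_refinements[OF AB] by blast
qed

end
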